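(* Let $n\ge 2$ be an integer and let $SD_{8n}=\langle a,b : a^{4n}=b^2=1,\ bab^{-1}=a^{2n-1}\rangle$ be the semidihedral group. Then each of the graphs $\Gamma=\mathrm{ESCom}(SD_{8n})$, $\Gamma=\mathrm{CSCom}(SD_{8n})$ and $\Gamma=\mathrm{OSCom}(SD_{8n})$ satisfies the Hansen--Vukičević inequality \[ \frac{M_2(\Gamma)}{|e(\Gamma)|}\ \ge\ \frac{M_1(\Gamma)}{|v(\Gamma)|}. \]
   Context: For an equivalence relation $B$ on a finite group $G$, with $[g]$ the class of $g$, the $B$ super commuting graph of $G$ is the simple graph with vertex set $G$ in which two distinct vertices $g,h$ are adjacent if and only if $[g]=[h]$ or there exist $g'\in[g]$, $h'\in[h]$ with $g'h'=h'g'$. It is denoted $\mathrm{ESCom}(G)$ when $B$ is equality (so $g\ne h$ are adjacent iff $gh=hg$), $\mathrm{CSCom}(G)$ when $B$ is conjugacy in $G$, and $\mathrm{OSCom}(G)$ when $B$ is the relation of having the same order. For a finite simple graph $\Gamma$ with vertex set $v(\Gamma)$ and edge set $e(\Gamma)$, the first and second Zagreb indices are $M_1(\Gamma)=\sum_{v\in v(\Gamma)}\deg(v)^2$ and $M_2(\Gamma)=\sum_{uv\in e(\Gamma)}\deg(u)\deg(v)$. *)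

theory Defs
  imports Complex_Main "HOL-Algebra.Multiplicative_Group"
begin

section \<open>Finite simple graphs and Zagreb indices\<close>

text \<open>A simple graph is a pair of a vertex set and a set of edges, each edge being
  a two-element set of vertices.\<close>

type_synonym 'a graph = "'a set \<times> 'a set set"

definition verts :: "'a graph \<Rightarrow> 'a set" where
  "verts \<Gamma> = fst \<Gamma>"

definition edges :: "'a graph \<Rightarrow> 'a set set" where
  "edges \<Gamma> = snd \<Gamma>"

definition degree :: "'a graph \<Rightarrow> 'a \<Rightarrow> nat" where
  "degree \<Gamma> v = card {e \<in> edges \<Gamma>. v \<in> e}"

definition zagreb1 :: "'a graph \<Rightarrow> nat" where
  "zagreb1 \<Gamma> = (\<Sum>v\<in>verts \<Gamma>. (degree \<Gamma> v)\<^sup>2)"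

definition zagreb2 :: "'a graph \<Rightarrow> nat" where
  "zagreb2 \<Gamma> = (\<Sum>e\<in>edges \<Gamma>. \<Prod>v\<in>e. degree \<Gamma> v)"


section \<open>Super commuting graphs\<close>

text \<open>The class of \<open>g\<close> under \<open>B\<close> is \<open>B `` {g}\<close>.\<close>

definition super_commuting_graph ::
    "('a, 'm) monoid_scheme \<Rightarrow> ('a \<times> 'a) set \<Rightarrow> 'a graph" where
  "super_commuting_graph G B =
     (carrier G,
      {{g, h} | g h. g \<in> carrier G \<and> h \<in> carrier G \<and> g \<noteq> h \<and>
         (B `` {g} = B `` {h} \<or>
          (\<exists>g'\<in>B `` {g}. \<exists>h'\<in>B `` {h}. g' \<otimes>\<^bsub>G\<^esub> h' = h' \<otimes>\<^bsub>G\<^esub> g'))})"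

definition conjugacy_rel :: "('a, 'm) monoid_scheme \<Rightarrow> ('a \<times> 'a) set" where
  "conjugacy_rel G = {(g, h). g \<in> carrier G \<and> h \<in> carrier G \<and>
     (\<exists>x\<in>carrier G. h = x \<otimes>\<^bsub>G\<^esub> g \<otimes>\<^bsub>G\<^esub> inv\<^bsub>G\<^esub> x)}"

definition same_order_rel :: "('a, 'm) monoid_scheme \<Rightarrow> ('a \<times> 'a) set" where
  "same_order_rel G = {(g, h). g \<in> carrier G \<and> h \<in> carrier G \<and> group.ord G g = group.ord G h}"

definition ESCom :: "('a, 'm) monoid_scheme \<Rightarrow> 'a graph" where
  "ESCom G = super_commuting_graph G (Id_on (carrier G))"

definition CSCom :: "('a, 'm) monoid_scheme \<Rightarrow> 'a graph" where
  "CSCom G = super_commuting_graph G (conjugacy_rel G)"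

definition OSCom :: "('a, 'm) monoid_scheme \<Rightarrow> 'a graph" where
  "OSCom G = super_commuting_graph G (same_order_rel G)"


section \<open>Groups given by generators and relations\<close>

text \<open>A letter \<open>(x, True)\<close> stands for the generator \<open>x\<close> and \<open>(x, False)\<close> for its formal
  inverse. A pair \<open>(l, r)\<close> of words in \<open>R\<close> stands for the defining relation \<open>l = r\<close>.
  Two words are related if they are equal in the group presented by \<open>R\<close>.\<close>

type_synonym 'g word = "('g \<times> bool) list"

inductive word_eq :: "('g word \<times> 'g word) set \<Rightarrow> 'g word \<Rightarrow> 'g word \<Rightarrow> bool"
  for R where
  refl: "word_eq R u u"
| sym: "word_eq R u v \<Longrightarrow> word_eq R v u"
| trans: "word_eq R u v \<Longrightarrow> word_eq R v w \<Longrightarrow> word_eq R u w"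
| cancel: "word_eq R (u @ [(x, s), (x, \<not> s)] @ v) (u @ v)"
| rel: "(l, r) \<in> R \<Longrightarrow> word_eq R (u @ l @ v) (u @ r @ v)"

definition word_class :: "('g word \<times> 'g word) set \<Rightarrow> 'g word \<Rightarrow> 'g word set" where
  "word_class R u = {v. word_eq R u v}"

definition presented_group :: "('g word \<times> 'g word) set \<Rightarrow> 'g word set monoid" where
  "presented_group R =
     \<lparr>carrier = range (word_class R),
      monoid.mult = (\<lambda>A B. \<Union>u\<in>A. \<Union>v\<in>B. word_class R (u @ v)),
      one = word_class R []\<rparr>"

lemma word_class_eq_iff: "word_class R u = word_class R v \<longleftrightarrow> word_eq R u v"
proof
  assume "word_class R u = word_class R v"
  moreover have "v \<in> word_class R v" by (simp add: word_class_def word_eq.refl)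
  ultimately show "word_eq R u v" by (simp add: word_class_def set_eq_iff)
next
  assume uv: "word_eq R u v"
  have "word_eq R u w \<longleftrightarrow> word_eq R v w" for w
    using word_eq.trans[OF uv, of w] word_eq.trans[OF word_eq.sym[OF uv], of w] by blast
  then show "word_class R u = word_class R v" by (simp add: word_class_def)
qed

lemma word_eq_context: "word_eq R u v \<Longrightarrow> word_eq R (p @ u @ q) (p @ v @ q)"
proof (induction rule: word_eq.induct)
  case (refl u)
  show ?case by (rule word_eq.refl)
next
  case (sym u v)
  from sym.IH show ?case by (rule word_eq.sym)
next
  case (trans u v w)
  from trans.IH show ?case by (rule word_eq.trans)
next
  case (cancel u x s v)
  show ?case using word_eq.cancel[of R "p @ u" x s "v @ q"] by simp
next
  case (rel l r u v)
  show ?case using word_eq.rel[OF rel, of "p @ u" "v @ q"] by simp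
qed

lemma word_eq_append: "word_eq R u u' \<Longrightarrow> word_eq R v v' \<Longrightarrow> word_eq R (u @ v) (u' @ v')"
  using word_eq_context[of R u u' "[]" v] word_eq_context[of R v v' u' "[]"]
    word_eq.trans[of R "u @ v" "u' @ v" "u' @ v'"]
  by simp

lemma presented_group_mult:
  "word_class R u \<otimes>\<^bsub>presented_group R\<^esub> word_class R v = word_class R (u @ v)"
proof -
  have "word_class R (u' @ v') = word_class R (u @ v)"
    if "u' \<in> word_class R u" "v' \<in> word_class R v" for u' v'
  proof -
    have "word_eq R (u @ v) (u' @ v')"
      using that word_eq_append[of R u u' v v'] by (simp add: word_class_def)
    then show ?thesis by (simp add: word_class_eq_iff[symmetric])
  qed
  moreover have "u \<in> word_class R u" "v \<in> word_class R v"
    by (simp_all add: word_class_def word_eq.refl)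
  ultimately have "(\<Union>u'\<in>word_class R u. \<Union>v'\<in>word_class R v. word_class R (u' @ v'))
      = word_class R (u @ v)"
    by blast
  then show ?thesis
    by (simp add: presented_group_def)
qed

lemma word_eq_inverse:
  "word_eq R (rev (map (\<lambda>(x, s). (x, \<not> s)) u) @ u) []"
proof (induction u)
  case Nil
  show ?case by (simp add: word_eq.refl)
next
  case (Cons a u)
  obtain x s where a: "a = (x, s)" by fastforce
  have "word_eq R (rev (map (\<lambda>(x, s). (x, \<not> s)) u) @ [(x, \<not> s), (x, \<not> \<not> s)] @ u)
          (rev (map (\<lambda>(x, s). (x, \<not> s)) u) @ u)"
    by (rule word_eq.cancel)
  from word_eq.trans[OF this Cons.IH] show ?case by (simp add: a)
qed

lemma group_presented_group: "group (presented_group R)"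
proof (rule groupI)
  fix A assume "A \<in> carrier (presented_group R)"
  then obtain u where "A = word_class R u" by (auto simp: presented_group_def)
  moreover have "word_class R v \<in> carrier (presented_group R)" for v
    by (simp add: presented_group_def)
  moreover have "word_class R (rev (map (\<lambda>(x, s). (x, \<not> s)) u)) \<otimes>\<^bsub>presented_group R\<^esub>
      word_class R u = \<one>\<^bsub>presented_group R\<^esub>"
    unfolding presented_group_mult
    by (simp add: presented_group_def word_class_eq_iff word_eq_inverse)
  ultimately show "\<exists>B\<in>carrier (presented_group R). B \<otimes>\<^bsub>presented_group R\<^esub> A = \<one>\<^bsub>presented_group R\<^esub>"
    by blast
next
  fix A assume "A \<in> carrier (presented_group R)"
  then obtain u where A: "A = word_class R u" by (auto simp: presented_group_def)
  have "\<one>\<^bsub>presented_group R\<^esub> = word_class R []" by (simp add: presented_group_def)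
  then show "\<one>\<^bsub>presented_group R\<^esub> \<otimes>\<^bsub>presented_group R\<^esub> A = A"
    by (simp add: A presented_group_mult)
next
  fix A B assume "A \<in> carrier (presented_group R)" "B \<in> carrier (presented_group R)"
  then obtain u v where "A = word_class R u" "B = word_class R v"
    by (auto simp: presented_group_def)
  then have "A \<otimes>\<^bsub>presented_group R\<^esub> B = word_class R (u @ v)"
    by (simp add: presented_group_mult)
  then show "A \<otimes>\<^bsub>presented_group R\<^esub> B \<in> carrier (presented_group R)"
    by (simp add: presented_group_def)
next
  fix A B C
  assume "A \<in> carrier (presented_group R)" "B \<in> carrier (presented_group R)"
    "C \<in> carrier (presented_group R)"
  then obtain u v w where "A = word_class R u" "B = word_class R v" "C = word_class R w"
    by (auto simp: presented_group_def)
  then show "A \<otimes>\<^bsub>presented_group R\<^esub> B \<otimes>\<^bsub>presented_group R\<^esub> C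
      = A \<otimes>\<^bsub>presented_group R\<^esub> (B \<otimes>\<^bsub>presented_group R\<^esub> C)"
    by (simp add: presented_group_mult)
qed (simp add: presented_group_def)


section \<open>The semidihedral groups\<close>

datatype sd_gen = GenA | GenB

definition semidihedral_rels :: "nat \<Rightarrow> (sd_gen word \<times> sd_gen word) set" where
  "semidihedral_rels n =
     {(replicate (4 * n) (GenA, True), []),
      (replicate 2 (GenB, True), []),
      ([(GenB, True), (GenA, True), (GenB, False)], replicate (2 * n - 1) (GenA, True))}"

text \<open>The group of order \<open>8 n\<close>; the index is \<open>n\<close>, not the order. The exponent
  \<open>2 * n - 1\<close> above is not truncated for \<open>n \<ge> 1\<close>.\<close>

definition semidihedral :: "nat \<Rightarrow> sd_gen word set monoid" where
  "semidihedral n = presented_group (semidihedral_rels n)"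


section \<open>The three relations are equivalence relations\<close>

lemma equiv_Id_on: "equiv (carrier G) (Id_on (carrier G))"
  by (auto simp: equiv_def refl_on_def sym_def trans_def)

lemma equiv_same_order_rel: "equiv (carrier G) (same_order_rel G)"
  by (auto simp: equiv_def refl_on_def sym_def trans_def same_order_rel_def)

lemma (in group) equiv_conjugacy_rel: "equiv (carrier G) (conjugacy_rel G)"
proof (rule equivI)
  show "conjugacy_rel G \<subseteq> carrier G \<times> carrier G"
    by (auto simp: conjugacy_rel_def)
  show "refl_on (carrier G) (conjugacy_rel G)"
    by (auto simp: refl_on_def conjugacy_rel_def intro!: bexI[of _ \<one>])
  show "sym (conjugacy_rel G)"
  proof (rule symI)
    fix g h assume "(g, h) \<in> conjugacy_rel G"
    then obtain x where x: "x \<in> carrier G" "g \<in> carrier G" "h = x \<otimes> g \<otimes> inv x"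
      by (auto simp: conjugacy_rel_def)
    moreover have "inv x \<otimes> (x \<otimes> g) = g"
      using x by (simp add: m_assoc[symmetric])
    ultimately have "g = inv x \<otimes> h \<otimes> inv (inv x)"
      by (simp add: m_assoc)
    moreover have "h \<in> carrier G" "inv x \<in> carrier G"
      using x by simp_all
    ultimately show "(h, g) \<in> conjugacy_rel G"
      using x(2) unfolding conjugacy_rel_def by blast
  qed
  show "trans (conjugacy_rel G)"
  proof (rule transI)
    fix g h k assume "(g, h) \<in> conjugacy_rel G" "(h, k) \<in> conjugacy_rel G"
    then obtain x y where x: "x \<in> carrier G" "y \<in> carrier G" "g \<in> carrier G"
        "k = y \<otimes> (x \<otimes> g \<otimes> inv x) \<otimes> inv y"
      by (auto simp: conjugacy_rel_def)
    then have "k = (y \<otimes> x) \<otimes> g \<otimes> inv (y \<otimes> x)"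
      by (simp add: m_assoc inv_mult_group)
    moreover have "k \<in> carrier G" "y \<otimes> x \<in> carrier G"
      using x by simp_all
    ultimately show "(g, k) \<in> conjugacy_rel G"
      using x(3) unfolding conjugacy_rel_def by blast
  qed
qed

end

theory Submission
  imports Defs
begin

text \<open>For a finite simple graph with \<open>N\<close> vertices, \<open>m\<close> edges and degrees \<open>d\<close>, writing
  \<open>2 d\<^sub>u d\<^sub>v = d\<^sub>u\<^sup>2 + d\<^sub>v\<^sup>2 - (d\<^sub>u - d\<^sub>v)\<^sup>2\<close> on the edges and expanding \<open>\<Sum>d \<cdot> \<Sum>d\<^sup>2\<close> gives the identity
  \<open>2 (N M\<^sub>2 - m M\<^sub>1) = \<Sum> (d\<^sub>u - d\<^sub>v)\<^sup>2 (d\<^sub>u + d\<^sub>v - N [uv is an edge])\<close>, summed over unordered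
  pairs \<open>u, v\<close>. So the Hansen--Vukicevic inequality holds as soon as adjacent vertices of
  different degrees have degree sum at least \<open>N\<close> (\<open>hansen_vukicevicI\<close>). No degree has to be
  computed for this.

  A super commuting graph satisfies this condition if there is a set \<open>D\<close> of vertices joined to
  everything such that adjacency is transitive off \<open>D\<close>: two adjacent vertices off \<open>D\<close> have the same
  closed neighbourhood, hence the same degree, while a vertex in \<open>D\<close> has degree \<open>N - 1\<close>
  (\<open>hansen_vukicevic_super_commuting_graph\<close>).

  In the semidihedral group the rotations, that is the powers of \<open>a\<close>, form an abelian subgroup
  of index at most two. In any such group commuting is transitive on the noncentral elements
  (\<open>commuting_transitive_if_abelian_index_2\<close>), and this survives passing to conjugates. So
  the centre serves as \<open>D\<close> both for equality and for conjugacy. For equal orders, \<open>D\<close> is the whole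
  group: every \<open>a\<^sup>k b\<close> has the same order as some rotation
  (\<open>rotation_of_same_order\<close>), and rotations commute, so the graph is complete. This last step needs
  \<open>a\<^bsup>2n\<^esup> \<noteq> 1\<close>, which does not follow by manipulating relations; it is read off from an action
  of the presented group on the integers modulo \<open>4 n\<close> (\<open>word_action_invariant\<close>).\<close>

section \<open>Graphs whose unequal adjacent degrees are large\<close>

definition hansen_vukicevic :: "'a graph \<Rightarrow> bool" where
  "hansen_vukicevic \<Gamma> \<longleftrightarrow>
     real (zagreb2 \<Gamma>) / real (card (edges \<Gamma>)) \<ge> real (zagreb1 \<Gamma>) / real (card (verts \<Gamma>))"

locale finite_simple_graph =
  fixes \<Gamma> :: "'a graph"
  assumes finite_verts: "finite (verts \<Gamma>)"
    and edge_cases: "e \<in> edges \<Gamma> \<Longrightarrow> \<exists>u\<in>verts \<Gamma>. \<exists>v\<in>verts \<Gamma>. u \<noteq> v \<and> e = {u, v}"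
begin

definition nbhd :: "'a \<Rightarrow> 'a set" where
  "nbhd v = {w. {v, w} \<in> edges \<Gamma>}"

definition darts :: "('a \<times> 'a) set" where
  "darts = {(u, v). {u, v} \<in> edges \<Gamma>}"

lemma edge_verts:
  assumes "{u, v} \<in> edges \<Gamma>"
  shows "u \<in> verts \<Gamma>" "v \<in> verts \<Gamma>" "u \<noteq> v"
  using edge_cases[OF assms] by (auto simp: doubleton_eq_iff)

lemma finite_edges: "finite (edges \<Gamma>)"
proof (rule finite_subset)
  show "edges \<Gamma> \<subseteq> Pow (verts \<Gamma>)"
    using edge_cases by blast
qed (simp add: finite_verts)

lemma nbhd_subset: "nbhd v \<subseteq> verts \<Gamma> - {v}"
proof
  fix w assume "w \<in> nbhd v"
  then have "{v, w} \<in> edges \<Gamma>"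
    by (simp add: nbhd_def)
  from edge_verts[OF this] show "w \<in> verts \<Gamma> - {v}"
    by simp
qed

lemma finite_nbhd: "finite (nbhd v)"
  using finite_subset[OF nbhd_subset] finite_verts by blast

lemma degree_eq_card_nbhd: "degree \<Gamma> v = card (nbhd v)"
proof -
  have "inj_on (\<lambda>w. {v, w}) (nbhd v)"
    by (auto simp: inj_on_def doubleton_eq_iff)
  moreover have "(\<lambda>w. {v, w}) ` nbhd v = {e \<in> edges \<Gamma>. v \<in> e}"
  proof (intro equalityI subsetI)
    fix e assume "e \<in> {e \<in> edges \<Gamma>. v \<in> e}"
    then have e: "e \<in> edges \<Gamma>" "v \<in> e"
      by auto
    then obtain w where "e = {v, w}"
      using edge_cases[OF e(1)] by (auto simp: insert_commute)
    then show "e \<in> (\<lambda>w. {v, w}) ` nbhd v"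
      using e by (auto simp: nbhd_def)
  qed (auto simp: nbhd_def)
  ultimately show ?thesis
    unfolding degree_def by (metis card_image)
qed

lemma darts_eq_Sigma: "darts = Sigma (verts \<Gamma>) nbhd"
  using edge_verts(1) by (auto simp: darts_def nbhd_def)

lemma sum_darts_fst:
  fixes f :: "'a \<Rightarrow> real"
  shows "(\<Sum>(u, v)\<in>darts. f u) = (\<Sum>u\<in>verts \<Gamma>. real (degree \<Gamma> u) * f u)"
  unfolding darts_eq_Sigma
  by (subst sum.Sigma[symmetric]) (simp_all add: finite_verts finite_nbhd degree_eq_card_nbhd)

lemma sum_darts_snd:
  fixes f :: "'a \<Rightarrow> real"
  shows "(\<Sum>(u, v)\<in>darts. f v) = (\<Sum>(u, v)\<in>darts. f u)"
  by (rule sum.reindex_bij_witness[of _ prod.swap prod.swap])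
    (auto simp: darts_def insert_commute)

text \<open>Each edge carries two darts, one in each direction.\<close>

lemma sum_darts_edges:
  fixes h :: "'a set \<Rightarrow> real"
  shows "(\<Sum>(u, v)\<in>darts. h {u, v}) = 2 * (\<Sum>e\<in>edges \<Gamma>. h e)"
proof -
  have "(\<Sum>(u, v)\<in>darts. h {u, v})
      = (\<Sum>e\<in>edges \<Gamma>. \<Sum>p\<in>{p \<in> darts. {fst p, snd p} = e}. h {fst p, snd p})"
    unfolding case_prod_unfold
  proof (rule sum.group[symmetric])
    show "finite darts"
      unfolding darts_eq_Sigma using finite_verts finite_nbhd by simp
  qed (auto simp: darts_def finite_edges)
  also have "\<dots> = (\<Sum>e\<in>edges \<Gamma>. 2 * h e)"
  proof (rule sum.cong[OF HOL.refl])
    fix e assume e: "e \<in> edges \<Gamma>"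
    then obtain u v where uv: "u \<noteq> v" "e = {u, v}"
      using edge_cases by blast
    have vu: "{v, u} = {u, v}"
      by (rule insert_commute)
    have "{u, v} \<in> edges \<Gamma>" "{v, u} \<in> edges \<Gamma>"
      using e uv by (simp_all add: vu)
    then have "{p \<in> darts. {fst p, snd p} = e} = {(u, v), (v, u)}"
      unfolding uv(2) by (auto simp: darts_def doubleton_eq_iff)
    then show "(\<Sum>p\<in>{p \<in> darts. {fst p, snd p} = e}. h {fst p, snd p}) = 2 * h e"
      using uv by (simp add: vu)
  qed
  finally show ?thesis
    by (simp add: sum_distrib_left)
qed

text \<open>All sums are taken over ordered pairs, which doubles the identity described at the top.
  Since \<open>(d u - d v)\<^sup>2 (d u + d v) = (d u)\<^sup>3 + (d v)\<^sup>3 - (d u)\<^sup>2 (d v) - (d u) (d v)\<^sup>2\<close>, its sum over all pairs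
  involves only \<open>N\<close>, the edge number, \<open>M\<^sub>1\<close> and the sum of the cubes, while the sum of
  \<open>(d u - d v)\<^sup>2\<close> over the darts involves only \<open>M\<^sub>2\<close> and the sum of the cubes. The hypothesis
  compares the two sums term by term on the darts, and the cubes cancel.\<close>

lemma hansen_vukicevicI:
  assumes large: "\<And>u v. {u, v} \<in> edges \<Gamma> \<Longrightarrow> degree \<Gamma> u \<noteq> degree \<Gamma> v
      \<Longrightarrow> card (verts \<Gamma>) \<le> degree \<Gamma> u + degree \<Gamma> v"
  shows "hansen_vukicevic \<Gamma>"
proof -
  define d where "d v = real (degree \<Gamma> v)" for v
  define V where "V = verts \<Gamma>"
  define N where "N = real (card V)"
  define m where "m = real (card (edges \<Gamma>))"
  have fin: "finite V"
    by (simp add: V_def finite_verts)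
  have M1: "real (zagreb1 \<Gamma>) = (\<Sum>v\<in>V. d v ^ 2)"
    by (simp add: zagreb1_def d_def V_def)
  have M2: "2 * real (zagreb2 \<Gamma>) = (\<Sum>(u, v)\<in>darts. d u * d v)"
  proof -
    have "(\<Sum>(u, v)\<in>darts. d u * d v) = (\<Sum>(u, v)\<in>darts. \<Prod>x\<in>{u, v}. d x)"
      using edge_verts(3) by (intro sum.cong) (auto simp: darts_def)
    also have "\<dots> = 2 * (\<Sum>e\<in>edges \<Gamma>. \<Prod>x\<in>e. d x)"
      by (rule sum_darts_edges)
    finally show ?thesis
      by (simp add: zagreb2_def d_def)
  qed
  have handshake: "2 * m = (\<Sum>v\<in>V. d v)"
    using sum_darts_edges[of "\<lambda>_. 1"] sum_darts_fst[of "\<lambda>_. 1"]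
    by (simp add: m_def d_def V_def)
  have cubes: "(\<Sum>(u, v)\<in>darts. d u ^ 2) = (\<Sum>v\<in>V. d v ^ 3)"
    unfolding sum_darts_fst d_def V_def by (simp add: power3_eq_cube power2_eq_square mult.assoc)
  have "N * (2 * (\<Sum>v\<in>V. d v ^ 3) - 4 * real (zagreb2 \<Gamma>))
      = N * (\<Sum>(u, v)\<in>darts. (d u - d v) ^ 2)"
  proof -
    have "(\<Sum>(u, v)\<in>darts. (d u - d v) ^ 2)
        = (\<Sum>(u, v)\<in>darts. d u ^ 2) + (\<Sum>(u, v)\<in>darts. d v ^ 2)
          - 2 * (\<Sum>(u, v)\<in>darts. d u * d v)"
      by (simp add: power2_diff case_prod_unfold sum.distrib sum_subtractf sum_distrib_left
          mult.assoc)
    then show ?thesis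
      unfolding sum_darts_snd[of "\<lambda>v. d v ^ 2"] cubes M2[symmetric] by simp
  qed
  also have "\<dots> \<le> (\<Sum>(u, v)\<in>darts. (d u - d v) ^ 2 * (d u + d v))"
    unfolding sum_distrib_left
  proof (rule sum_mono, clarify)
    fix u v assume "(u, v) \<in> darts"
    then have "degree \<Gamma> u = degree \<Gamma> v \<or> card V \<le> degree \<Gamma> u + degree \<Gamma> v"
      using large[of u v] by (auto simp: darts_def V_def)
    then have "d u = d v \<or> N \<le> d u + d v"
      by (auto simp: d_def N_def)
    then show "N * (d u - d v) ^ 2 \<le> (d u - d v) ^ 2 * (d u + d v)"
      by (auto simp: mult.commute[of N] intro: mult_left_mono)
  qed
  also have "\<dots> \<le> (\<Sum>(u, v)\<in>V \<times> V. (d u - d v) ^ 2 * (d u + d v))"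
    using edge_verts
    by (intro sum_mono2) (auto simp: fin darts_def V_def finite_verts d_def)
  also have "\<dots> = 2 * (N * (\<Sum>v\<in>V. d v ^ 3)) - 2 * ((\<Sum>v\<in>V. d v) * (\<Sum>v\<in>V. d v ^ 2))"
  proof -
    have expand: "(d u - d v) ^ 2 * (d u + d v)
        = d u ^ 3 + d v ^ 3 - d u ^ 2 * d v - d u * d v ^ 2" for u v
      by (simp add: power2_eq_square power3_eq_cube algebra_simps)
    show ?thesis
      unfolding sum.cartesian_product[symmetric] expand
      by (simp add: sum.distrib sum_subtractf sum_distrib_left[symmetric]
          sum_distrib_right[symmetric] N_def algebra_simps)
  qed
  finally have main: "m * real (zagreb1 \<Gamma>) \<le> N * real (zagreb2 \<Gamma>)"
    unfolding M1 handshake[symmetric] by (simp add: algebra_simps)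
  show ?thesis
  proof (cases "edges \<Gamma> = {}")
    case True
    \<comment> \<open>The left quotient is \<open>x / 0 = 0\<close>, so the first Zagreb index has to vanish as well.\<close>
    then have "zagreb1 \<Gamma> = 0"
      by (simp add: zagreb1_def degree_def)
    then show ?thesis
      by (simp add: hansen_vukicevic_def)
  next
    case False
    then have "m > 0"
      by (simp add: m_def card_gt_0_iff finite_edges)
    moreover have "N > 0"
      using False edge_cases fin by (auto simp: N_def V_def card_gt_0_iff)
    ultimately show ?thesis
      using main unfolding hansen_vukicevic_def m_def[symmetric] V_def[symmetric] N_def[symmetric]
      by (simp add: field_simps)
  qed
qed

end

section \<open>Super commuting graphs\<close>

definition joined :: "('a, 'm) monoid_scheme \<Rightarrow> ('a \<times> 'a) set \<Rightarrow> 'a \<Rightarrow> 'a \<Rightarrow> bool" where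
  "joined G B g h \<longleftrightarrow> B `` {g} = B `` {h} \<or>
     (\<exists>g'\<in>B `` {g}. \<exists>h'\<in>B `` {h}. g' \<otimes>\<^bsub>G\<^esub> h' = h' \<otimes>\<^bsub>G\<^esub> g')"

lemma joined_sym: "joined G B g h \<Longrightarrow> joined G B h g"
  unfolding joined_def by metis

lemma verts_super_commuting_graph [simp]: "verts (super_commuting_graph G B) = carrier G"
  by (simp add: verts_def super_commuting_graph_def)

lemma edge_super_commuting_graph_iff:
  "{g, h} \<in> edges (super_commuting_graph G B) \<longleftrightarrow>
     g \<in> carrier G \<and> h \<in> carrier G \<and> g \<noteq> h \<and> joined G B g h"
proof -
  have "edges (super_commuting_graph G B)
      = {{g, h} | g h. g \<in> carrier G \<and> h \<in> carrier G \<and> g \<noteq> h \<and> joined G B g h}"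
    by (simp add: edges_def super_commuting_graph_def joined_def)
  then show ?thesis
    using joined_sym by (fastforce simp: doubleton_eq_iff)
qed

lemma finite_simple_super_commuting_graph:
  assumes "finite (carrier G)"
  shows "finite_simple_graph (super_commuting_graph G B)"
proof
  show "finite (verts (super_commuting_graph G B))"
    using assms by simp
  show "\<exists>u\<in>verts (super_commuting_graph G B). \<exists>v\<in>verts (super_commuting_graph G B).
      u \<noteq> v \<and> e = {u, v}" if "e \<in> edges (super_commuting_graph G B)" for e
    using that unfolding verts_super_commuting_graph
    by (simp add: edges_def super_commuting_graph_def) blast
qed

text \<open>Take an edge \<open>u v\<close>. If \<open>u\<close> lies in \<open>D\<close>, then \<open>u\<close> has degree \<open>N - 1\<close> and \<open>v\<close> has degree at least
  \<open>1\<close>, so the degrees add up to at least \<open>N\<close>. If neither end lies in \<open>D\<close>, transitivity makes the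
  closed neighbourhoods of \<open>u\<close> and \<open>v\<close> equal, so the degrees agree.\<close>

lemma hansen_vukicevic_super_commuting_graph:
  assumes fin: "finite (carrier G)"
    and dominating: "\<And>g h. g \<in> D \<Longrightarrow> h \<in> carrier G \<Longrightarrow> joined G B g h"
    and trans: "\<And>u v w. u \<in> carrier G - D \<Longrightarrow> v \<in> carrier G - D \<Longrightarrow> w \<in> carrier G - D
      \<Longrightarrow> joined G B u v \<Longrightarrow> joined G B v w \<Longrightarrow> joined G B u w"
  shows "hansen_vukicevic (super_commuting_graph G B)"
proof -
  let ?\<Gamma> = "super_commuting_graph G B"
  interpret finite_simple_graph ?\<Gamma>
    by (rule finite_simple_super_commuting_graph[OF fin])
  have nbhd_iff: "w \<in> nbhd v \<longleftrightarrow> v \<in> carrier G \<and> w \<in> carrier G \<and> v \<noteq> w \<and> joined G B v w" for v w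
    by (simp add: nbhd_def edge_super_commuting_graph_iff)
  have large: "card (carrier G) \<le> degree ?\<Gamma> u + degree ?\<Gamma> v"
    if "u \<in> D" "{u, v} \<in> edges ?\<Gamma>" for u v
  proof -
    have u: "u \<in> carrier G"
      using that by (simp add: edge_super_commuting_graph_iff)
    have "nbhd u = carrier G - {u}"
      using u dominating[OF that(1)] by (auto simp: nbhd_iff)
    then have "Suc (degree ?\<Gamma> u) = card (carrier G)"
      using u fin card.remove[of "carrier G" u] by (simp add: degree_eq_card_nbhd)
    moreover have "u \<in> nbhd v"
      using that by (simp add: nbhd_def insert_commute)
    then have "0 < degree ?\<Gamma> v"
      using finite_nbhd by (auto simp: degree_eq_card_nbhd card_gt_0_iff)
    ultimately show ?thesis
      by simp
  qed
  show ?thesis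
  proof (rule hansen_vukicevicI)
    fix u v
    assume uv: "{u, v} \<in> edges ?\<Gamma>" and ne: "degree ?\<Gamma> u \<noteq> degree ?\<Gamma> v"
    have uv': "u \<in> carrier G" "v \<in> carrier G" "u \<noteq> v" "joined G B u v" "joined G B v u"
      using uv joined_sym by (auto simp: edge_super_commuting_graph_iff)
    show "card (verts ?\<Gamma>) \<le> degree ?\<Gamma> u + degree ?\<Gamma> v"
    proof (cases "u \<in> D \<or> v \<in> D")
      case True
      then show ?thesis
        using large[of u v] large[of v u] uv by (auto simp: insert_commute)
    next
      case False
      have joined_iff: "joined G B u w \<longleftrightarrow> joined G B v w" if "w \<in> carrier G" for w
      proof (cases "w \<in> D")
        case True
        then show ?thesis
          using dominating[of w u] dominating[of w v] joined_sym[of G B w u] joined_sym[of G B w v]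
            uv' by simp
      next
        case w: False
        then show ?thesis
          using trans[of u v w] trans[of v u w] that uv' False by blast
      qed
      have "insert u (nbhd u) = insert v (nbhd v)"
      proof (rule Set.set_eqI)
        fix w
        show "w \<in> insert u (nbhd u) \<longleftrightarrow> w \<in> insert v (nbhd v)"
          using uv' joined_iff[of w] by (cases "w = u"; cases "w = v") (auto simp: nbhd_iff)
      qed
      moreover have "u \<notin> nbhd u" "v \<notin> nbhd v"
        by (simp_all add: nbhd_iff)
      ultimately have "card (nbhd u) = card (nbhd v)"
        using finite_nbhd by (metis card_insert_disjoint nat.inject)
      then show ?thesis
        using ne by (simp add: degree_eq_card_nbhd)
    qed
  qed
qed

section \<open>Groups in which commuting is transitive off the centre\<close>

context group
begin

definition central :: "'a set" where
  "central = {z \<in> carrier G. \<forall>g\<in>carrier G. z \<otimes> g = g \<otimes> z}"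

definition commuting_transitive :: bool where
  "commuting_transitive \<longleftrightarrow>
     (\<forall>u\<in>carrier G - central. \<forall>v\<in>carrier G - central. \<forall>w\<in>carrier G - central.
        u \<otimes> v = v \<otimes> u \<longrightarrow> v \<otimes> w = w \<otimes> v \<longrightarrow> u \<otimes> w = w \<otimes> u)"

text \<open>Let \<open>x\<close> lie outside \<open>A\<close>. An element of \<open>A\<close> that commutes with \<open>x\<close> commutes with \<open>A\<close> and with
  \<open>A x\<close>, so it is central. Hence a noncentral element of \<open>A\<close> commutes exactly with
  the elements of \<open>A\<close>, and the elements commuting with \<open>x\<close> are central or
  central multiples of \<open>x\<close>. Both kinds of centralizer are abelian.\<close>

lemma commuting_transitive_if_abelian_index_2:
  assumes A: "subgroup A G"
    and comm: "\<And>s t. s \<in> A \<Longrightarrow> t \<in> A \<Longrightarrow> s \<otimes> t = t \<otimes> s"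
    and b: "b \<in> carrier G"
    and cover: "carrier G = A \<union> (A #> b)"
  shows commuting_transitive
proof -
  have A_carrier: "s \<in> carrier G" if "s \<in> A" for s
    using subgroup.mem_carrier[OF A that] .
  have quotient: "\<exists>s\<in>A. x = s \<otimes> y" if "x \<in> carrier G - A" "y \<in> carrier G - A" for x y
  proof -
    have "x \<in> A #> b" "y \<in> A #> b"
      using that by (auto simp: cover)
    then obtain s t where st: "s \<in> A" "x = s \<otimes> b" "t \<in> A" "y = t \<otimes> b"
      by (auto simp: r_coset_def)
    have "inv t \<otimes> (t \<otimes> b) = b"
      using st b A_carrier by (simp add: m_assoc[symmetric])
    then have "x = (s \<otimes> inv t) \<otimes> y"
      using st b A_carrier by (simp add: m_assoc)
    then show ?thesis
      using st subgroup.m_closed[OF A] subgroup.m_inv_closed[OF A] by blast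
  qed
  have meets: "s \<in> central" if s: "s \<in> A" and x: "x \<in> carrier G - A" and sx: "s \<otimes> x = x \<otimes> s" for s x
  proof -
    have "s \<otimes> g = g \<otimes> s" if g: "g \<in> carrier G" for g
    proof (cases "g \<in> A")
      case False
      then obtain t where t: "t \<in> A" "g = t \<otimes> x"
        using quotient g x by blast
      have "s \<otimes> g = (t \<otimes> s) \<otimes> x"
        using s t x A_carrier comm[of s t] by (simp add: m_assoc[symmetric])
      also have "\<dots> = g \<otimes> s"
        using s t x A_carrier by (simp add: sx m_assoc)
      finally show ?thesis .
    qed (use comm s in blast)
    then show ?thesis
      using s A_carrier by (simp add: central_def)
  qed
  show ?thesis
    unfolding commuting_transitive_def
  proof (intro ballI impI)
    fix u v w
    assume u: "u \<in> carrier G - central" and v: "v \<in> carrier G - central"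
      and w: "w \<in> carrier G - central" and uv: "u \<otimes> v = v \<otimes> u" and vw: "v \<otimes> w = w \<otimes> v"
    show "u \<otimes> w = w \<otimes> u"
    proof (cases "v \<in> A")
      case True
      then have "u \<in> A" "w \<in> A"
        using meets[OF True, of u] meets[OF True, of w] u v w uv vw by auto
      then show ?thesis
        by (rule comm)
    next
      case False
      then have "u \<notin> A"
        using meets[of u v] u v uv by auto
      then obtain s where s: "s \<in> A" "u = s \<otimes> v"
        using quotient[of u v] u v False by blast
      have "s \<otimes> v = v \<otimes> s"
        using uv s v A_carrier by (metis DiffD1 m_assoc m_closed right_cancel)
      then have "s \<in> central"
        using meets s v False by blast
      then have "u \<otimes> w = s \<otimes> (w \<otimes> v)" "w \<otimes> u = s \<otimes> (w \<otimes> v)"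
        using s v w vw A_carrier by (auto simp: central_def m_assoc) (metis m_assoc)
      then show ?thesis
        by simp
    qed
  qed
qed

lemma hansen_vukicevic_ESCom:
  assumes fin: "finite (carrier G)" and commuting_transitive
  shows "hansen_vukicevic (ESCom G)"
  unfolding ESCom_def
proof (rule hansen_vukicevic_super_commuting_graph[OF fin, where D = central])
  have joined_iff: "joined G (Id_on (carrier G)) g h \<longleftrightarrow> g \<otimes> h = h \<otimes> g"
    if "g \<in> carrier G" "h \<in> carrier G" for g h
    using that by (auto simp: joined_def Id_on_def)
  show "joined G (Id_on (carrier G)) g h" if "g \<in> central" "h \<in> carrier G" for g h
    using that joined_iff by (auto simp: central_def)
  show "joined G (Id_on (carrier G)) u w"
    if "u \<in> carrier G - central" "v \<in> carrier G - central" "w \<in> carrier G - central"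
      "joined G (Id_on (carrier G)) u v" "joined G (Id_on (carrier G)) v w" for u v w
  proof -
    have "u \<otimes> v = v \<otimes> u" "v \<otimes> w = w \<otimes> v"
      using that joined_iff[of u v] joined_iff[of v w] by simp_all
    then have "u \<otimes> w = w \<otimes> u"
      using that(1-3) assms(2) unfolding commuting_transitive_def by blast
    then show ?thesis
      using that joined_iff[of u w] by simp
  qed
qed

lemma conjugate_mult:
  assumes "x \<in> carrier G" "g \<in> carrier G" "h \<in> carrier G"
  shows "(x \<otimes> g \<otimes> inv x) \<otimes> (x \<otimes> h \<otimes> inv x) = x \<otimes> (g \<otimes> h) \<otimes> inv x"
proof -
  have "inv x \<otimes> (x \<otimes> (h \<otimes> inv x)) = h \<otimes> inv x"
    using assms by (simp add: m_assoc[symmetric])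
  then show ?thesis
    using assms by (simp add: m_assoc)
qed

lemma conjugate_conjugate:
  assumes "x \<in> carrier G" "y \<in> carrier G" "g \<in> carrier G"
  shows "x \<otimes> (y \<otimes> g \<otimes> inv y) \<otimes> inv x = (x \<otimes> y) \<otimes> g \<otimes> inv (x \<otimes> y)"
  using assms by (simp add: m_assoc inv_mult_group)

lemma conjugate_inverse:
  assumes "x \<in> carrier G" "g \<in> carrier G"
  shows "inv x \<otimes> (x \<otimes> g \<otimes> inv x) \<otimes> inv (inv x) = g"
  using conjugate_conjugate[of "inv x" x g] assms by simp

lemma conjugate_noncentral:
  assumes x: "x \<in> carrier G" and g: "g \<in> carrier G - central"
  shows "x \<otimes> g \<otimes> inv x \<in> carrier G - central"
proof -
  have "x \<otimes> g \<otimes> inv x \<notin> central"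
  proof
    assume c: "x \<otimes> g \<otimes> inv x \<in> central"
    have fixed: "inv x \<otimes> z \<otimes> inv (inv x) = z" if "z \<in> central" for z
    proof -
      have z: "z \<in> carrier G" "inv x \<otimes> z = z \<otimes> inv x"
        using that x by (simp_all add: central_def)
      show ?thesis
        unfolding z(2) using z(1) x by (simp add: m_assoc)
    qed
    have "g = x \<otimes> g \<otimes> inv x"
      using fixed[OF c] conjugate_inverse[of x g] x g by simp
    then show False
      using c g by simp
  qed
  then show ?thesis
    using x g by simp
qed

text \<open>If some conjugates of \<open>g\<close> and \<open>h\<close> commute, conjugating back moves the first one to \<open>g\<close> itself; equal
  classes are the case in which a conjugate of \<open>h\<close> is \<open>g\<close>. This one-sided form is what makes
  adjacency compose.\<close>

lemma joined_conjugacy_iff: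
  assumes g: "g \<in> carrier G" and h: "h \<in> carrier G"
  shows "joined G (conjugacy_rel G) g h \<longleftrightarrow>
    (\<exists>x\<in>carrier G. g \<otimes> (x \<otimes> h \<otimes> inv x) = (x \<otimes> h \<otimes> inv x) \<otimes> g)" (is "_ \<longleftrightarrow> ?R")
proof
  assume "joined G (conjugacy_rel G) g h"
  then consider "conjugacy_rel G `` {g} = conjugacy_rel G `` {h}"
    | g' h' where "(g, g') \<in> conjugacy_rel G" "(h, h') \<in> conjugacy_rel G" "g' \<otimes> h' = h' \<otimes> g'"
    unfolding joined_def by blast
  then show ?R
  proof cases
    case 1
    then have "(h, g) \<in> conjugacy_rel G"
      using equiv_class_eq_iff[OF equiv_conjugacy_rel, of h g] g h by simp
    then obtain x where "x \<in> carrier G" "g = x \<otimes> h \<otimes> inv x"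
      by (auto simp: conjugacy_rel_def)
    then show ?R
      by auto
  next
    case 2
    then obtain p q where p: "p \<in> carrier G" "g' = p \<otimes> g \<otimes> inv p"
      and q: "q \<in> carrier G" "h' = q \<otimes> h \<otimes> inv q"
      by (auto simp: conjugacy_rel_def)
    let ?c = "\<lambda>y. inv p \<otimes> y \<otimes> inv (inv p)"
    have "?c g' = g"
      using conjugate_inverse p g by simp
    moreover have "?c h' = (inv p \<otimes> q) \<otimes> h \<otimes> inv (inv p \<otimes> q)"
      using conjugate_conjugate[of "inv p" q h] p q h by simp
    moreover have "?c g' \<otimes> ?c h' = ?c h' \<otimes> ?c g'"
      using conjugate_mult[of "inv p" g' h'] conjugate_mult[of "inv p" h' g'] 2(3) p q g h
      by simp
    ultimately show ?R
      using p q by (metis inv_closed m_closed)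
  qed
next
  assume ?R
  then obtain x where x: "x \<in> carrier G" "g \<otimes> (x \<otimes> h \<otimes> inv x) = (x \<otimes> h \<otimes> inv x) \<otimes> g"
    by blast
  have "(h, x \<otimes> h \<otimes> inv x) \<in> conjugacy_rel G"
    using x h by (auto simp: conjugacy_rel_def)
  moreover have "(g, g) \<in> conjugacy_rel G"
    using equiv_conjugacy_rel g by (simp add: equiv_def refl_on_def)
  ultimately show "joined G (conjugacy_rel G) g h"
    using x unfolding joined_def by blast
qed

text \<open>If \<open>u\<close> commutes with a conjugate of \<open>v\<close> by \<open>x\<close>, and \<open>v\<close> commutes with a conjugate of \<open>w\<close> by \<open>y\<close>, then
  conjugating the second pair by \<open>x\<close> gives a chain of commuting elements from \<open>u\<close> to the conjugate
  of \<open>w\<close> by \<open>x y\<close>. The elements stay noncentral, so commuting can be composed.\<close>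

lemma hansen_vukicevic_CSCom:
  assumes fin: "finite (carrier G)" and ct: commuting_transitive
  shows "hansen_vukicevic (CSCom G)"
  unfolding CSCom_def
proof (rule hansen_vukicevic_super_commuting_graph[OF fin, where D = central])
  show "joined G (conjugacy_rel G) g h" if "g \<in> central" "h \<in> carrier G" for g h
    using that joined_conjugacy_iff[of g h] by (auto simp: central_def)
next
  fix u v w
  assume u: "u \<in> carrier G - central" and v: "v \<in> carrier G - central"
    and w: "w \<in> carrier G - central"
    and uv: "joined G (conjugacy_rel G) u v" and vw: "joined G (conjugacy_rel G) v w"
  obtain x where x: "x \<in> carrier G" "u \<otimes> (x \<otimes> v \<otimes> inv x) = (x \<otimes> v \<otimes> inv x) \<otimes> u"
    using uv joined_conjugacy_iff[of u v] u v by blast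
  obtain y where y: "y \<in> carrier G" "v \<otimes> (y \<otimes> w \<otimes> inv y) = (y \<otimes> w \<otimes> inv y) \<otimes> v"
    using vw joined_conjugacy_iff[of v w] v w by blast
  define v' where "v' = x \<otimes> v \<otimes> inv x"
  define w' where "w' = x \<otimes> (y \<otimes> w \<otimes> inv y) \<otimes> inv x"
  have v': "v' \<in> carrier G - central" and w': "w' \<in> carrier G - central"
    using conjugate_noncentral x y v w by (simp_all only: v'_def w'_def)
  have "v' \<otimes> w' = w' \<otimes> v'"
    using conjugate_mult[of x v "y \<otimes> w \<otimes> inv y"] conjugate_mult[of x "y \<otimes> w \<otimes> inv y" v] x y v w
    by (simp add: v'_def w'_def)
  then have "u \<otimes> w' = w' \<otimes> u"
    using ct u v' w' x(2) unfolding commuting_transitive_def v'_def by blast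
  moreover have "w' = (x \<otimes> y) \<otimes> w \<otimes> inv (x \<otimes> y)"
    using conjugate_conjugate x y w by (simp add: w'_def)
  ultimately show "joined G (conjugacy_rel G) u w"
    using joined_conjugacy_iff[of u w] u w x y by auto
qed

text \<open>Under these hypotheses any two vertices are joined through representatives in \<open>A\<close>, so the graph
  is complete.\<close>

lemma hansen_vukicevic_OSCom_if_orders_in_abelian_subset:
  assumes fin: "finite (carrier G)"
    and A: "A \<subseteq> carrier G"
    and comm: "\<And>s t. s \<in> A \<Longrightarrow> t \<in> A \<Longrightarrow> s \<otimes> t = t \<otimes> s"
    and orders: "\<And>g. g \<in> carrier G \<Longrightarrow> \<exists>s\<in>A. ord s = ord g"
  shows "hansen_vukicevic (OSCom G)"
  unfolding OSCom_def
proof (rule hansen_vukicevic_super_commuting_graph[OF fin, where D = "carrier G"])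
  fix g h assume "g \<in> carrier G" "h \<in> carrier G"
  then obtain s t where "s \<in> A" "ord s = ord g" "t \<in> A" "ord t = ord h"
    "g \<in> carrier G" "h \<in> carrier G"
    using orders by metis
  moreover from this have "s \<in> same_order_rel G `` {g}" "t \<in> same_order_rel G `` {h}"
    using A by (auto simp: same_order_rel_def)
  ultimately show "joined G (same_order_rel G) g h"
    using comm[of s t] unfolding joined_def by blast
qed auto

end

section \<open>The semidihedral group\<close>

text \<open>A group generated by two elements that satisfy the defining relations may be a proper quotient of
  the semidihedral group; \<open>half_turn\<close> excludes those in which the order of \<open>a\<close> divides \<open>2 n\<close>.\<close>

locale semidihedral_pair = group +
  fixes a b :: 'a and n :: nat
  assumes a_closed [simp]: "a \<in> carrier G"
    and b_closed [simp]: "b \<in> carrier G"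
    and n_pos: "n > 0"
    and a_pow: "a [^] (4 * n) = \<one>"
    and b_square: "b \<otimes> b = \<one>"
    and b_a: "b \<otimes> a = a [^] (2 * n - 1) \<otimes> b"
    and half_turn: "a [^] (2 * n) \<noteq> \<one>"
    and generated: "carrier G = generate G {a, b}"
begin

lemma ord_a_nonzero: "ord a \<noteq> 0"
proof
  assume "ord a = 0"
  then show False
    using pow_eq_id[of a "4 * n"] a_pow n_pos by simp
qed

lemma rotations: "generate G {a} = {a [^] k | k::nat. True}"
  using generate_pow_nat[of a] ord_a_nonzero by auto

lemma rotations_commute: "s \<in> generate G {a} \<Longrightarrow> t \<in> generate G {a} \<Longrightarrow> s \<otimes> t = t \<otimes> s"
  unfolding rotations using nat_pow_comm by auto

lemma b_a_pow: "b \<otimes> a [^] k = a [^] ((2 * n - 1) * k) \<otimes> b"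
proof (induction k)
  case (Suc k)
  have "b \<otimes> a [^] Suc k = (b \<otimes> a [^] k) \<otimes> a"
    by (simp add: m_assoc)
  also have "\<dots> = a [^] ((2 * n - 1) * k) \<otimes> (b \<otimes> a)"
    by (simp add: Suc m_assoc)
  also have "\<dots> = a [^] ((2 * n - 1) * k) \<otimes> a [^] (2 * n - 1) \<otimes> b"
    by (simp add: b_a m_assoc)
  also have "\<dots> = a [^] ((2 * n - 1) * Suc k) \<otimes> b"
    by (simp add: nat_pow_mult add.commute)
  finally show ?case .
qed simp

text \<open>By \<open>b_a_pow\<close> every \<open>b\<close> can be moved to the right of all powers of \<open>a\<close>, and two of them cancel.\<close>

lemma cover: "carrier G = generate G {a} \<union> (generate G {a} #> b)"
proof
  have A: "subgroup (generate G {a}) G"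
    by (rule generate_is_subgroup) simp
  have swap: "\<exists>t\<in>generate G {a}. b \<otimes> s = t \<otimes> b" if "s \<in> generate G {a}" for s
    using that b_a_pow unfolding rotations by blast
  have in_A: "s \<in> carrier G" if "s \<in> generate G {a}" for s
    using subgroup.mem_carrier[OF A that] .
  show "carrier G \<subseteq> generate G {a} \<union> (generate G {a} #> b)"
  proof
    fix g assume "g \<in> carrier G"
    then have "g \<in> generate G {a, b}"
      by (simp only: generated)
    then show "g \<in> generate G {a} \<union> (generate G {a} #> b)"
    proof (induction rule: generate.induct)
      case one
      show ?case by (simp add: generate.one)
    next
      case (incl h)
      have "b = \<one> \<otimes> b" by simp
      then have "b \<in> generate G {a} #> b"
        unfolding r_coset_def using generate.one by blast
      then show ?case using incl by (auto intro: generate.incl)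
    next
      case (inv h)
      have "inv b = \<one> \<otimes> b"
        using b_square by (simp add: inv_equality)
      then have "inv b \<in> generate G {a} #> b"
        unfolding r_coset_def using generate.one by blast
      then show ?case using inv by (auto intro: generate.inv)
    next
      case (eng g h)
      have left: "s \<otimes> x \<in> generate G {a} \<union> (generate G {a} #> b)"
        if "s \<in> generate G {a}" "x \<in> generate G {a} \<union> (generate G {a} #> b)" for s x
        using that in_A by (auto simp: r_coset_def m_assoc[symmetric] intro: generate.eng)
      have bh: "b \<otimes> h \<in> generate G {a} \<union> (generate G {a} #> b)"
      proof (cases "h \<in> generate G {a}")
        case True
        then show ?thesis
          using swap unfolding r_coset_def by blast
      next
        case False
        then obtain s where s: "s \<in> generate G {a}" "h = s \<otimes> b"
          using eng.IH(2) unfolding r_coset_def by blast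
        obtain t where t: "t \<in> generate G {a}" "b \<otimes> s = t \<otimes> b"
          using swap s by blast
        have "b \<otimes> h = (b \<otimes> s) \<otimes> b"
          using s in_A by (simp add: m_assoc)
        also have "\<dots> = t"
          using t in_A by (simp add: m_assoc b_square)
        finally show ?thesis
          using t by simp
      qed
      have "h \<in> carrier G"
        using eng.hyps(2) unfolding generated .
      show ?case
      proof (cases "g \<in> generate G {a}")
        case True
        then show ?thesis
          using left eng.IH(2) by blast
      next
        case False
        then obtain s where "s \<in> generate G {a}" "g = s \<otimes> b"
          using eng.IH(1) unfolding r_coset_def by blast
        then show ?thesis
          using left[of s "b \<otimes> h"] bh \<open>h \<in> carrier G\<close> in_A
          by (simp add: m_assoc)
      qed
    qed
  qed
  show "generate G {a} \<union> (generate G {a} #> b) \<subseteq> carrier G"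
    using in_A by (auto simp: r_coset_def)
qed

lemma finite_carrier: "finite (carrier G)"
proof -
  have "finite (generate G {a})"
    using generate_pow_card[of a] ord_a_nonzero by (metis a_closed card.infinite)
  then show ?thesis
    unfolding cover by (simp add: r_coset_def)
qed

lemma commuting_transitive: commuting_transitive
  by (rule commuting_transitive_if_abelian_index_2[OF _ rotations_commute _ cover])
    (simp_all add: generate_is_subgroup)

text \<open>The exponent is \<open>k + (2 n - 1) k = 2 n k\<close>, so the square depends only on the parity of \<open>k\<close>. The
  elements \<open>a\<^sup>k b\<close> thus have order at most \<open>4\<close>.\<close>

lemma reflection_square:
  fixes k :: nat
  shows "(a [^] k \<otimes> b) [^] (2::nat) = (a [^] (2 * n)) [^] k"
proof -
  have "(a [^] k \<otimes> b) [^] (2::nat) = (a [^] k \<otimes> b) \<otimes> (a [^] k \<otimes> b)"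
    by (simp add: numeral_2_eq_2)
  also have "\<dots> = a [^] k \<otimes> (b \<otimes> a [^] k) \<otimes> b"
    by (simp add: m_assoc)
  also have "\<dots> = (a [^] k \<otimes> a [^] ((2 * n - 1) * k)) \<otimes> (b \<otimes> b)"
    unfolding b_a_pow by (simp add: m_assoc)
  also have "\<dots> = a [^] (k + (2 * n - 1) * k)"
    by (simp add: b_square nat_pow_mult)
  also have "k + (2 * n - 1) * k = (2 * n) * k"
    using n_pos by (cases n) (auto simp: algebra_simps)
  finally show ?thesis
    by (simp add: nat_pow_pow)
qed

lemma ord_eq_2:
  assumes "x \<in> carrier G" "x \<noteq> \<one>" "x [^] (2::nat) = \<one>"
  shows "ord x = 2"
proof -
  have "ord x dvd 2" "ord x \<noteq> 1"
    using assms pow_eq_id[of x 2] ord_eq_1[of x] by auto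
  moreover from this(1) have "ord x \<le> 2"
    by (rule dvd_imp_le) simp
  then have "ord x \<in> {0, 1, 2}"
    by auto
  ultimately show ?thesis
    by auto
qed

lemma ord_eq_4:
  assumes x: "x \<in> carrier G" and sq: "x [^] (2::nat) = a [^] (2 * n)"
  shows "ord x = 4"
proof -
  have "x [^] (4::nat) = (x [^] (2::nat)) [^] (2::nat)"
    using x by (simp add: nat_pow_pow)
  also have "\<dots> = \<one>"
    unfolding sq using a_pow by (simp add: nat_pow_pow mult.commute)
  finally have "ord x dvd 4"
    using pow_eq_id x by blast
  moreover from this have "ord x \<le> 4"
    by (rule dvd_imp_le) simp
  then have "ord x \<in> {0, 1, 2, 3, 4}"
    by auto
  moreover have "\<not> ord x dvd 2"
    using pow_eq_id[of x 2] x sq half_turn by simp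
  ultimately show ?thesis
    by auto
qed

text \<open>An element \<open>a\<^sup>k b\<close> that is not a rotation is different from \<open>\<one>\<close>. For even \<open>k\<close> it has order \<open>2\<close>, like
  \<open>a\<^bsup>2n\<^esup>\<close>; for odd \<open>k\<close> its square is \<open>a\<^bsup>2n\<^esup>\<close>, so it has order \<open>4\<close>, like \<open>a\<^sup>n\<close>.\<close>

lemma rotation_of_same_order:
  assumes "g \<in> carrier G"
  shows "\<exists>s\<in>generate G {a}. ord s = ord g"
proof (cases "g \<in> generate G {a}")
  case False
  then have "g \<in> generate G {a} #> b"
    using assms by (auto simp: cover)
  then obtain k :: nat where g: "g = a [^] k \<otimes> b"
    by (auto simp: r_coset_def rotations)
  have turn: "a [^] (2 * n) \<in> generate G {a}" "a [^] n \<in> generate G {a}"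
    "\<one> \<in> generate G {a}"
    by (auto simp: rotations intro: exI[of _ 0])
  have turn_square: "(a [^] (2 * n)) [^] (2::nat) = \<one>"
    using a_pow by (simp add: nat_pow_pow mult.commute)
  show ?thesis
  proof (cases "even k")
    case True
    then obtain j where "k = 2 * j" ..
    then have "g [^] (2::nat) = ((a [^] (2 * n)) [^] (2::nat)) [^] j"
      unfolding g reflection_square by (simp add: nat_pow_pow mult.assoc mult.left_commute)
    then have "ord g = 2"
      using ord_eq_2[OF assms] False turn turn_square by auto
    moreover have "ord (a [^] (2 * n)) = 2"
      using ord_eq_2 half_turn turn_square by simp
    ultimately show ?thesis
      using turn by auto
  next
    case False
    then obtain j where "k = 2 * j + 1"
      by (rule oddE)
    then have "g [^] (2::nat) = ((a [^] (2 * n)) [^] (2::nat)) [^] j \<otimes> a [^] (2 * n)"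
      unfolding g reflection_square by (simp add: nat_pow_pow nat_pow_mult algebra_simps)
    then have "ord g = 4"
      using ord_eq_4[OF assms] turn_square by simp
    moreover have "ord (a [^] n) = 4"
      using ord_eq_4 by (simp add: nat_pow_pow mult.commute)
    ultimately show ?thesis
      using turn by auto
  qed
qed blast

end

text \<open>The generator \<open>a\<close> acts as translation by \<open>1\<close> and \<open>b\<close> as multiplication by \<open>2 n - 1\<close>. The relations
  hold for these maps modulo \<open>4 n\<close>, since \<open>(2 n - 1)\<^sup>2 = 4 n (n - 1) + 1\<close>; for the same reason \<open>b\<close> and
  its formal inverse may act alike. The values are left unreduced, and only their residues modulo
  \<open>4 n\<close> are meaningful.\<close>

fun letter_action :: "nat \<Rightarrow> sd_gen \<times> bool \<Rightarrow> int \<Rightarrow> int" where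
  "letter_action n (GenA, s) k = (if s then k + 1 else k - 1)"
| "letter_action n (GenB, s) k = (2 * int n - 1) * k"

definition word_action :: "nat \<Rightarrow> sd_gen word \<Rightarrow> int \<Rightarrow> int" where
  "word_action n w k = foldr (letter_action n) w k"

lemma word_action_append: "word_action n (u @ v) k = word_action n u (word_action n v k)"
  by (simp add: word_action_def)

lemma word_action_cong:
  "k mod (4 * int n) = l mod (4 * int n)
    \<Longrightarrow> word_action n w k mod (4 * int n) = word_action n w l mod (4 * int n)"
proof (induction w)
  case (Cons x w)
  then show ?case
    by (cases "(n, x, k)" rule: letter_action.cases)
      (auto simp: word_action_def intro: mod_add_cong mod_diff_cong mod_mult_cong)
qed (simp add: word_action_def)

lemma word_action_replicate_GenA: "word_action n (replicate m (GenA, True)) k = k + int m"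
  by (induction m) (simp_all add: word_action_def)

lemma reflection_involutive_mod:
  "(2 * int n - 1) * ((2 * int n - 1) * k) mod (4 * int n) = k mod (4 * int n)"
proof -
  have "(2 * int n - 1) * ((2 * int n - 1) * k) = k + ((int n - 1) * k) * (4 * int n)"
    by (simp add: algebra_simps)
  then show ?thesis
    by simp
qed

lemma word_action_invariant:
  assumes "n > 0" "word_eq (semidihedral_rels n) u v"
  shows "word_action n u k mod (4 * int n) = word_action n v k mod (4 * int n)"
  using assms(2)
proof (induction arbitrary: k rule: word_eq.induct)
  case (cancel u x s v)
  have "word_action n [(x, s), (x, \<not> s)] l mod (4 * int n) = l mod (4 * int n)" for l
    using reflection_involutive_mod by (cases x) (auto simp: word_action_def)
  then show ?case
    unfolding word_action_append by (intro word_action_cong) simp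
next
  case (rel l r u v)
  have "word_action n l j mod (4 * int n) = word_action n r j mod (4 * int n)" for j
  proof -
    have "(2 * int n - 1) * ((2 * int n - 1) * j + 1)
        = (2 * int n - 1) * ((2 * int n - 1) * j) + (2 * int n - 1)"
      by (simp add: algebra_simps)
    then have "(2 * int n - 1) * ((2 * int n - 1) * j + 1) mod (4 * int n)
        = (j + (2 * int n - 1)) mod (4 * int n)"
      using reflection_involutive_mod by (metis mod_add_left_eq)
    then show ?thesis
      using rel assms(1) reflection_involutive_mod[of n j] word_action_replicate_GenA
      by (auto simp: semidihedral_rels_def numeral_2_eq_2 of_nat_diff) (auto simp: word_action_def)
  qed
  then show ?case
    unfolding word_action_append by (intro word_action_cong)
qed auto

lemma semidihedral_pair_semidihedral:
  assumes n: "n > 0"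
  shows "semidihedral_pair (semidihedral n)
    (word_class (semidihedral_rels n) [(GenA, True)])
    (word_class (semidihedral_rels n) [(GenB, True)]) n"
proof -
  define R where "R = semidihedral_rels n"
  define a where "a = word_class R [(GenA, True)]"
  define b where "b = word_class R [(GenB, True)]"
  define G where "G = semidihedral n"
  have G_eq: "G = presented_group R"
    by (simp add: G_def R_def semidihedral_def)
  interpret group G
    unfolding G_eq by (rule group_presented_group)
  have mult: "word_class R u \<otimes>\<^bsub>G\<^esub> word_class R v = word_class R (u @ v)" for u v
    unfolding G_eq by (rule presented_group_mult)
  have one: "\<one>\<^bsub>G\<^esub> = word_class R []"
    by (simp add: G_eq presented_group_def)
  have closed [simp]: "word_class R w \<in> carrier G" for w
    by (simp add: G_eq presented_group_def)
  have relation: "word_class R l = word_class R r" if "(l, r) \<in> R" for l r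
    using word_eq.rel[OF that, of "[]" "[]"] by (simp add: word_class_eq_iff)
  have pow: "a [^]\<^bsub>G\<^esub> k = word_class R (replicate k (GenA, True))" for k :: nat
    by (induction k) (simp_all add: one a_def mult replicate_append_same)
  have cancelling: "word_class R [(x, s), (x, \<not> s)] = \<one>\<^bsub>G\<^esub>" for x s
    using word_eq.cancel[of R "[]" x s "[]"] by (simp add: one word_class_eq_iff)
  have a_inv: "word_class R [(GenA, False)] = inv\<^bsub>G\<^esub> a"
    using cancelling[of GenA False] by (intro inv_equality[symmetric]) (simp_all add: a_def mult)
  have b_inv: "word_class R [(GenB, False)] = inv\<^bsub>G\<^esub> b"
    using cancelling[of GenB False] by (intro inv_equality[symmetric]) (simp_all add: b_def mult)
  have ab [simp]: "a \<in> carrier G" "b \<in> carrier G"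
    by (simp_all add: a_def b_def)
  have a_pow: "a [^]\<^bsub>G\<^esub> (4 * n) = \<one>\<^bsub>G\<^esub>"
    unfolding pow one by (rule relation) (simp add: R_def semidihedral_rels_def)
  have b_square: "b \<otimes>\<^bsub>G\<^esub> b = \<one>\<^bsub>G\<^esub>"
    unfolding b_def mult one
    by (rule relation) (simp add: R_def semidihedral_rels_def numeral_2_eq_2)
  have "b \<otimes>\<^bsub>G\<^esub> a \<otimes>\<^bsub>G\<^esub> inv\<^bsub>G\<^esub> b = a [^]\<^bsub>G\<^esub> (2 * n - 1)"
    unfolding pow b_inv[symmetric] unfolding a_def b_def mult
    by (rule relation) (simp add: R_def semidihedral_rels_def)
  then have b_a: "b \<otimes>\<^bsub>G\<^esub> a = a [^]\<^bsub>G\<^esub> (2 * n - 1) \<otimes>\<^bsub>G\<^esub> b"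
    by (metis ab inv_solve_right' m_closed nat_pow_closed)
  have half_turn: "a [^]\<^bsub>G\<^esub> (2 * n) \<noteq> \<one>\<^bsub>G\<^esub>"
  proof
    assume "a [^]\<^bsub>G\<^esub> (2 * n) = \<one>\<^bsub>G\<^esub>"
    then have "word_eq R (replicate (2 * n) (GenA, True)) []"
      by (simp add: pow one word_class_eq_iff)
    \<comment> \<open>The power acts on \<open>0\<close> as translation by \<open>2 n\<close>, which is not \<open>0\<close> modulo \<open>4 n\<close>.\<close>
    from word_action_invariant[OF n this[unfolded R_def], of 0]
    show False
      using n by (simp add: word_action_replicate_GenA) (simp add: word_action_def)
  qed
  have words: "word_class R w \<in> generate G {a, b}" for w
  proof (induction w)
    case Nil
    show ?case by (simp add: one[symmetric] generate.one)
  next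
    case (Cons l w)
    obtain x s where l: "l = (x, s)" by fastforce
    have "word_class R [l] \<in> generate G {a, b}"
      by (cases x; cases s)
        (auto simp: l a_inv b_inv a_def[symmetric] b_def[symmetric]
          intro: generate.incl generate.inv)
    from generate.eng[OF this Cons] show ?case
      by (simp add: mult)
  qed
  have generated: "carrier G = generate G {a, b}"
  proof (intro equalityI subsetI)
    fix x assume "x \<in> carrier G"
    then obtain w where "x = word_class R w"
      by (auto simp: G_eq presented_group_def)
    then show "x \<in> generate G {a, b}"
      using words by simp
  qed (use generate_incl[of "{a, b}"] ab in blast)
  show ?thesis
    unfolding R_def[symmetric] a_def[symmetric] b_def[symmetric] G_def[symmetric]
    by unfold_locales (fact ab n a_pow b_square b_a half_turn generated)+
qed

theorem theorem3p5:
  fixes n :: nat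
  assumes "n \<ge> 2"
  shows "\<forall>\<Gamma> \<in> {ESCom (semidihedral n), CSCom (semidihedral n), OSCom (semidihedral n)}.
           real (zagreb2 \<Gamma>) / real (card (edges \<Gamma>)) \<ge> real (zagreb1 \<Gamma>) / real (card (verts \<Gamma>))"
proof -
  interpret semidihedral_pair "semidihedral n"
    "word_class (semidihedral_rels n) [(GenA, True)]"
    "word_class (semidihedral_rels n) [(GenB, True)]" n
    using assms by (intro semidihedral_pair_semidihedral) simp
  have "hansen_vukicevic (ESCom (semidihedral n))" "hansen_vukicevic (CSCom (semidihedral n))"
    "hansen_vukicevic (OSCom (semidihedral n))"
    using hansen_vukicevic_ESCom hansen_vukicevic_CSCom
      hansen_vukicevic_OSCom_if_orders_in_abelian_subset[OF _ _ rotations_commute rotation_of_same_order]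
      finite_carrier commuting_transitive generate_incl[of "{word_class (semidihedral_rels n) [(GenA, True)]}"]
    by simp_all
  then show ?thesis
    by (simp add: hansen_vukicevic_def)
qed

end
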